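(* $$\sup_{(X,\mathcal{B},\mu,T)}\ \sup_{f\in L^1_+(\mu),\ \|f\|_1=1}\ \sup_{\lambda>0}\ \lambda\cdot\mu\left\{x\in X:\ \sup_{n\ge 1}\frac{\mathbf{N}_n(f)(x)}{n}>\lambda\right\}=\infty,$$ where the first supremum is taken over all measure preserving systems $(X,\mathcal{B},\mu,T)$.
   Context: A measure preserving system $(X,\mathcal{B},\mu,T)$ consists of a probability space $(X,\mathcal{B},\mu)$ and an invertible measure preserving transformation $T$ of it. $L^1_+(\mu)$ denotes the nonnegative functions in $L^1(\mu)$. For $f\in L^1_+(\mu)$ and a positive integer $n$, $\mathbf{N}_n(f)(x)=\#\left\{k\in\{1,2,3,\dots\}:\ \frac{f(T^kx)}{k}>\frac1n\right\}$, which is finite for $\mu$-a.e. $x$. *)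

theory Defs
  imports "HOL-Probability.Probability"
begin

definition measure_preserving :: "'a measure \<Rightarrow> ('a \<Rightarrow> 'a) \<Rightarrow> bool" where
  "measure_preserving M T \<longleftrightarrow> T \<in> M \<rightarrow>\<^sub>M M \<and> distr M M T = M"

text \<open>Invertibility is meant everywhere on the space, with a measurable inverse. Nothing is
  required of \<open>T\<close> outside \<open>space M\<close>.\<close>

definition measure_preserving_system :: "'a measure \<Rightarrow> ('a \<Rightarrow> 'a) \<Rightarrow> bool" where
  "measure_preserving_system M T \<longleftrightarrow>
     prob_space M \<and> measure_preserving M T \<and>
     bij_betw T (space M) (space M) \<and> the_inv_into (space M) T \<in> M \<rightarrow>\<^sub>M M"

definition L1_plus :: "'a measure \<Rightarrow> ('a \<Rightarrow> real) set" where
  "L1_plus M = {f. integrable M f \<and> (\<forall>x\<in>space M. 0 \<le> f x)}"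

definition L1_norm :: "'a measure \<Rightarrow> ('a \<Rightarrow> real) \<Rightarrow> real" where
  "L1_norm M f = (\<integral>x. \<bar>f x\<bar> \<partial>M)"

text \<open>Counting measure rather than \<^const>\<open>card\<close>, so that the count is \<open>\<infinity>\<close>, not \<open>0\<close>, at the
  points (a null set) where infinitely many \<open>k\<close> qualify.\<close>

definition count_N :: "('a \<Rightarrow> 'a) \<Rightarrow> nat \<Rightarrow> ('a \<Rightarrow> real) \<Rightarrow> 'a \<Rightarrow> ennreal" where
  "count_N T n f x =
     emeasure (count_space UNIV) {k::nat. 1 \<le> k \<and> f ((T ^^ k) x) / real k > 1 / real n}"

end

theory Submission
  imports Defs
begin

text \<open>
  Suppose that \<open>f = v\<^sub>1 1\<^bsub>A(1)\<^esub> + \<dots> + v\<^sub>K 1\<^bsub>A(K)\<^esub>\<close> with disjoint \<open>A(j)\<close>. Then \<open>\<^bold>N\<^sub>n(f)(x)\<close> counts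
  the visits of \<open>x\<close> to \<open>A(j)\<close> during the first \<open>n v\<^sub>j\<close> steps, summed over \<open>j\<close>, so \<open>\<^bold>N\<^sub>n(f)/n\<close> is the
  sum of the ergodic averages of \<open>v\<^sub>j 1\<^bsub>A(j)\<^esub>\<close> over windows of length \<open>n v\<^sub>j\<close>. If the \<open>v\<^sub>j\<close> are
  very far apart, these averages live on disjoint ranges of scales, and the set \<open>A(j)\<close> may be chosen
  with full knowledge of what happens at the larger scales, that is, for the larger \<open>j\<close>.

  The time parameter \<open>n\<close> runs through a long geometric progression with exponent \<open>t\<close> in an
  interval of integers. One stage of the construction, of norm 1, cuts the current interval of
  times into \<open>L + 1\<close> pieces. On the latest piece the average of \<open>v\<^sub>j 1\<^bsub>A(j)\<^esub>\<close> equals 1. Whenever one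
  passes to the piece before, half of the space loses \<open>A(j)\<close> altogether and the average doubles on
  the other half. A point that survives exactly \<open>l\<close> of these \<open>L\<close> cuts keeps the piece on which it sees
  the average \<open>2^l\<close>, and the next stage cuts only that piece. The expected gain of a stage
  is \<open>1 + L/2\<close>, although its cost is 1. Stages are repeated at a point until its total gain reaches
  \<open>\<Lambda> = 2^L\<close>. Since a gain is at least 1 and at most \<open>2^L\<close>, this needs at most \<open>\<Lambda>\<close> stages and
  overshoots to at most \<open>\<Lambda> + 2^L\<close>, so by optional stopping the total cost is at most
  \<open>(\<Lambda> + 2^L)/(1 + L/2)\<close>. Every point sees the gains of all its stages
  at one and the same time, which add up to at least \<open>\<Lambda>\<close>, hence the weak type quotient is of the order of \<open>L\<close>.

  Everything takes place in a rotation of a finite cyclic group, whose elements are written in a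
  large base. The halving at a cut is the parity of one digit. Windows are one-sided whereas the sets
  are described by digits, and the two fit together unless a carry occurs; the points with a largest
  possible digit are discarded, and they fill at most half of the space when the base is
  large. The cost is bounded in \<open>sum_F_le\<close>, the gain in \<open>stage_count\<close> (for one stage) and
  \<open>F_count\<close>, and \<open>rotation_weak_type_bound\<close> passes from counting to measure.
\<close>

section \<open>Counting with digits\<close>

lemma sum_lessThan_mult:
  fixes f :: "nat \<Rightarrow> 'a::comm_monoid_add"
  shows "(\<Sum>x<a * b. f x) = (\<Sum>u<a. \<Sum>y<b. f (u * b + y))"
proof -
  have "(\<Sum>x<a * b. f x) = (\<Sum>u<a. sum f {u * b..<u * b + b})"
    by (rule sum.nat_group [symmetric])
  also have "\<dots> = (\<Sum>u<a. \<Sum>y<b. f (u * b + y))"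
  proof (rule sum.cong [OF refl])
    fix u
    show "sum f {u * b..<u * b + b} = (\<Sum>y<b. f (u * b + y))"
      using sum.shift_bounds_nat_ivl [of f 0 "u * b" b]
      by (simp add: add.commute atLeast0LessThan)
  qed
  finally show ?thesis .
qed

lemma sum_even_lessThan_double:
  fixes g h :: nat
  shows "(\<Sum>u<2 * m. if even u then g else h) = m * g + m * h"
  by (induction m) (simp_all add: algebra_simps)

text \<open>A window as long as the period meets every residue class once, wherever it starts.\<close>

lemma card_window_mod:
  fixes x C :: nat
  assumes "0 < C"
  shows "card {i \<in> {1..C}. R ((x + i) mod C)} = card {y \<in> {..<C}. R y}"
proof -
  have inj: "inj_on (\<lambda>i. (x + i) mod C) {1..C}"
  proof (rule linorder_inj_onI)
    fix i j :: nat
    assume ij: "i < j" "i \<in> {1..C}" "j \<in> {1..C}"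
    show "(x + i) mod C \<noteq> (x + j) mod C"
    proof
      assume "(x + i) mod C = (x + j) mod C"
      then have "C dvd (x + j) - (x + i)"
        using ij by (subst mod_eq_dvd_iff_nat [symmetric]) auto
      then have "C dvd j - i" by simp
      then have "C \<le> j - i" using ij by (intro dvd_imp_le) auto
      then show False using ij by auto
    qed
  qed auto
  have "(\<lambda>i. (x + i) mod C) ` {1..C} \<subseteq> {..<C}" using assms by auto
  then have img: "(\<lambda>i. (x + i) mod C) ` {1..C} = {..<C}"
    using card_image [OF inj] by (intro card_subset_eq) auto
  have "bij_betw (\<lambda>i. (x + i) mod C) {i \<in> {1..C}. R ((x + i) mod C)} {y \<in> {..<C}. R y}"
    unfolding bij_betw_def
  proof
    show "inj_on (\<lambda>i. (x + i) mod C) {i \<in> {1..C}. R ((x + i) mod C)}"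
      using inj by (rule inj_on_subset) auto
    have "f ` {i \<in> A. R (f i)} = {y \<in> f ` A. R y}" for f :: "nat \<Rightarrow> nat" and A by auto
    from this [of "\<lambda>i. (x + i) mod C" "{1..C}"]
    show "(\<lambda>i. (x + i) mod C) ` {i \<in> {1..C}. R ((x + i) mod C)} = {y \<in> {..<C}. R y}"
      unfolding img .
  qed
  then show ?thesis by (rule bij_betw_same_card)
qed

text \<open>Adding at most one unit of the digit at \<open>C\<close> raises that digit by at most one. If it is not the
  largest digit, all higher digits stay the same.\<close>

lemma add_div_no_carry:
  fixes x i C B :: nat
  assumes "0 < C" "i \<le> C" "(x div C) mod B \<noteq> B - 1" "0 < B"
  shows "(x + i) div (C * B) = x div (C * B)"
proof -
  have "(x + i) div C = x div C \<or> (x + i) div C = Suc (x div C)"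
  proof -
    have "(x + i) div C \<le> (x + C) div C" using assms by (intro div_le_mono) auto
    moreover have "(x + C) div C = Suc (x div C)" using assms by simp
    moreover have "x div C \<le> (x + i) div C" by (intro div_le_mono) auto
    ultimately show ?thesis by linarith
  qed
  moreover have "Suc (x div C mod B) \<noteq> B" using assms by auto
  then have "Suc (x div C) div B = x div C div B" by (simp add: div_Suc mod_Suc)
  ultimately show ?thesis by (auto simp: div_mult2_eq)
qed

section \<open>The cascade of stages\<close>

text \<open>\<open>L\<close> is the number of cuts in a stage and \<open>T\<close> the number of times available. The factor \<open>D\<close> serves
  to make the base large; it is even so that parities of digits are fair coins even if \<open>L = 0\<close>.\<close>

locale cascade =
  fixes L D T :: nat
  assumes D_even: "even D" and D_pos: "0 < D"
begin

definition B :: nat where "B = 2 ^ L * D"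
text \<open>Stage \<open>Suc k\<close> owns the \<open>2 * T\<close> digits from \<open>P k\<close> upwards: the even positions are for cuts, the odd
  ones for the ends of windows. The lowest block of digits belongs to no stage. It keeps the supports
  of the stages disjoint.\<close>

definition P :: "nat \<Rightarrow> nat" where "P k = B ^ (Suc k * (2 * T))"
text \<open>The number of cuts, taken from the latest time downwards, that \<open>z\<close> survives before it is
  killed for the first time.\<close>

definition lev :: "nat list \<Rightarrow> nat \<Rightarrow> nat" where
  "lev ps z = length (takeWhile (\<lambda>p. even (z div B ^ p)) ps)"
text \<open>The interval of \<open>Suc L ^ Suc k\<close> times that starts at \<open>lo\<close> is divided into \<open>Suc L\<close> pieces of
  length \<open>Suc L ^ k\<close>; the cuts are at their common boundaries, the latest first.\<close>

definition cuts :: "nat \<Rightarrow> nat \<Rightarrow> nat list" where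
  "cuts k lo = map (\<lambda>i. 2 * (lo + (L - i) * Suc L ^ k)) [0..<L]"

text \<open>The function built by \<open>k\<close> stages with times from \<open>lo\<close> onwards and a gain of \<open>\<Lambda>\<close> still to be
  reached. The top stage puts the value \<open>P k * 2 ^ L\<close> on one residue class modulo \<open>P k\<close>, thinned out
  by the \<open>L\<close> cuts to density \<open>1 / (P k * 2 ^ L)\<close>; so it costs 1. The higher digits then tell the lower stages
  which piece of the times remains and how much has been gained. Truncated subtraction
  implements the stopping rule, because nothing is spent once \<open>\<Lambda> = 0\<close>.\<close>

primrec F :: "nat \<Rightarrow> nat \<Rightarrow> nat \<Rightarrow> nat \<Rightarrow> nat" where
  "F 0 lo \<Lambda> x = 0"
| "F (Suc k) lo \<Lambda> x =
    (if \<Lambda> = 0 then 0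
     else let l = lev (cuts k lo) (x div P k) in
       (if l = L \<and> x mod P k = Suc k then P k * 2 ^ L else 0)
       + F k (lo + (L - l) * Suc L ^ k) (\<Lambda> - 2 ^ l) (x mod P k))"

text \<open>The points at which no window causes a carry.\<close>

definition good :: "nat \<Rightarrow> bool" where
  "good x \<longleftrightarrow> (\<forall>p. (x div B ^ p) mod B \<noteq> B - 1)"

lemma B_even: "even B" using D_even by (simp add: B_def)
lemma B_pos: "0 < B" using D_pos by (simp add: B_def)
lemma B_ge2: "2 \<le> B" using B_even B_pos by (cases "B = 1") auto
lemma P_pos: "0 < P k" using B_pos by (simp add: P_def)
lemma P_Suc: "P (Suc k) = P k * B ^ (2 * T)"
proof -
  have "Suc (Suc k) * (2 * T) = Suc k * (2 * T) + 2 * T" by simp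
  then show ?thesis unfolding P_def by (simp only: power_add)
qed

lemma even_mod_div:
  assumes "q < p" shows "even ((z mod B ^ p) div B ^ q) = even (z div B ^ q)"
proof -
  have e: "B ^ p = B ^ q * B ^ (p - q)" using assms by (simp flip: power_add)
  have "(z mod B ^ p) div B ^ q = (z div B ^ q) mod B ^ (p - q)"
    unfolding e by (simp add: mod_mult2_eq B_pos)
  moreover have "2 dvd B ^ (p - q)" using B_even assms by (simp)
  ultimately show ?thesis by (simp add: dvd_mod_iff)
qed

text \<open>The parity of the digit at \<open>p\<close> is a fair coin independent of the lower digits. The moments of
  \<open>lev\<close> and the density of the survivors both follow from this by induction on the list of cuts.\<close>

lemma halving_sum:
  fixes h :: "nat \<Rightarrow> nat"
  assumes "p < M" and h: "\<And>z. h (z mod B ^ p) = h z"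
  shows "2 * (\<Sum>z<B ^ M. if even (z div B ^ p) then h z else c)
       = (\<Sum>z<B ^ M. h z) + B ^ M * c"
proof -
  obtain m where m: "B ^ (M - p) = 2 * m"
    using B_even assms by (metis dvd_def even_power zero_less_diff less_numeral_extra(3))
  have BM: "B ^ M = 2 * m * B ^ p"
    using assms by (simp flip: m power_add)
  have hh: "h (u * B ^ p + y) = h y" for u y
    using h [of "u * B ^ p + y"] h [of y] by simp
  have "(\<Sum>z<B ^ M. if even (z div B ^ p) then h z else c)
      = (\<Sum>u<2 * m. \<Sum>y<B ^ p. if even u then h y else c)"
    unfolding BM sum_lessThan_mult
    by (intro sum.cong refl) (use B_pos in \<open>auto simp: hh\<close>)
  also have "\<dots> = (\<Sum>u<2 * m. if even u then (\<Sum>y<B ^ p. h y) else B ^ p * c)"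
    by (intro sum.cong refl) auto
  also have "\<dots> = m * (\<Sum>y<B ^ p. h y) + m * (B ^ p * c)"
    by (rule sum_even_lessThan_double)
  finally have 1: "(\<Sum>z<B ^ M. if even (z div B ^ p) then h z else c)
      = m * (\<Sum>y<B ^ p. h y) + m * (B ^ p * c)" .
  have 2: "(\<Sum>z<B ^ M. h z) = 2 * m * (\<Sum>y<B ^ p. h y)"
    unfolding BM sum_lessThan_mult by (simp add: hh)
  show ?thesis unfolding 1 2 by (simp add: BM algebra_simps)
qed

lemma lev_mod:
  assumes "\<forall>q\<in>set ps. q < p" shows "lev ps (z mod B ^ p) = lev ps z"
  unfolding lev_def
  by (rule arg_cong [where f = length], rule takeWhile_cong)
     (use assms even_mod_div in auto)

text \<open>The expected gain of a stage is \<open>1 + L/2\<close>: each additional cut at the late end doubles the old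
  gain with probability \<open>1/2\<close> and otherwise fixes it to 1, and so adds \<open>1/2\<close> to the mean.\<close>

lemma sum_power_lev:
  assumes "sorted_wrt (>) ps" "\<forall>p\<in>set ps. p < M"
  shows "2 * (\<Sum>z<B ^ M. 2 ^ lev ps z) = (length ps + 2) * B ^ M"
  using assms
proof (induction ps)
  case Nil
  then show ?case by (simp add: lev_def)
next
  case (Cons p ps)
  have eq: "(2::nat) ^ lev (p # ps) z = (if even (z div B ^ p) then 2 * 2 ^ lev ps z else 1)" for z
    by (simp add: lev_def)
  have "2 * (\<Sum>z<B ^ M. 2 ^ lev (p # ps) z) = (\<Sum>z<B ^ M. 2 * 2 ^ lev ps z) + B ^ M * 1"
    unfolding eq using Cons.prems by (intro halving_sum) (auto simp: lev_mod)
  also have "(\<Sum>z<B ^ M. 2 * 2 ^ lev ps z) = (2::nat) * (\<Sum>z<B ^ M. 2 ^ lev ps z)"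
    by (rule sum_distrib_left [symmetric])
  finally show ?case using Cons by simp
qed

lemma card_all_even:
  assumes "sorted_wrt (>) ps" "\<forall>p\<in>set ps. p < M"
  shows "2 ^ length ps * card {z \<in> {..<B ^ M}. \<forall>p\<in>set ps. even (z div B ^ p)} = B ^ M"
proof -
  have "2 ^ length ps * (\<Sum>z<B ^ M. of_bool (\<forall>p\<in>set ps. even (z div B ^ p))) = B ^ M"
    using assms
  proof (induction ps)
    case (Cons p ps)
    have eq: "(of_bool (\<forall>q\<in>set (p # ps). even (z div B ^ q)) :: nat)
        = (if even (z div B ^ p) then of_bool (\<forall>q\<in>set ps. even (z div B ^ q)) else 0)" for z
      by simp
    have half: "2 * (\<Sum>z<B ^ M. of_bool (\<forall>q\<in>set (p # ps). even (z div B ^ q)))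
        = (\<Sum>z<B ^ M. of_bool (\<forall>q\<in>set ps. even (z div B ^ q))) + B ^ M * 0"
      unfolding eq using Cons.prems
      by (intro halving_sum) (auto intro!: arg_cong [where f = of_bool] ball_cong simp: even_mod_div)
    have "(2::nat) ^ length (p # ps) * (\<Sum>z<B ^ M. of_bool (\<forall>q\<in>set (p # ps). even (z div B ^ q)))
        = 2 ^ length ps * (2 * (\<Sum>z<B ^ M. of_bool (\<forall>q\<in>set (p # ps). even (z div B ^ q))))"
      by (simp only: list.size(4) add_Suc_right add_0_right power_Suc mult_ac)
    also have "\<dots> = B ^ M" unfolding half using Cons by simp
    finally show ?case .
  qed simp
  then show ?thesis by (simp add: Int_def conj_commute)
qed

lemma sorted_cuts: "sorted_wrt (>) (cuts k lo)"
proof -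
  have "(L - j) * Suc L ^ k < (L - i) * Suc L ^ k" if "i < j" "j < L" for i j
    using that by (intro mult_strict_right_mono) auto
  then show ?thesis by (auto simp: cuts_def sorted_wrt_iff_nth_less)
qed

lemma length_cuts: "length (cuts k lo) = L" by (simp add: cuts_def)

lemma cuts_less:
  assumes "lo + Suc L ^ Suc k \<le> T" "p \<in> set (cuts k lo)" shows "p < 2 * T"
proof -
  obtain i where i: "i < L" "p = 2 * (lo + (L - i) * Suc L ^ k)"
    using assms by (auto simp: cuts_def)
  have "(L - i) * Suc L ^ k < Suc L * Suc L ^ k" by (intro mult_strict_right_mono) auto
  then show ?thesis using i assms by simp
qed

lemma piece_le: "(L - l) * Suc L ^ k + Suc L ^ k \<le> Suc L ^ Suc k"
  using mult_le_mono1 [of "Suc (L - l)" "Suc L" "Suc L ^ k"] by simp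

lemma lev_le: "lev (cuts k lo) z \<le> L"
  using length_takeWhile_le [of _ "cuts k lo"] by (simp add: lev_def length_cuts)

lemma lev_eq_L_iff: "lev (cuts k lo) z = L \<longleftrightarrow> (\<forall>p\<in>set (cuts k lo). even (z div B ^ p))"
proof -
  have "length (takeWhile Q xs) = length xs \<longleftrightarrow> (\<forall>x\<in>set xs. Q x)" for Q and xs :: "nat list"
    by (metis takeWhile_eq_all_conv takeWhile_eq_take take_all order_refl)
  from this [of _ "cuts k lo"] show ?thesis by (simp add: lev_def length_cuts)
qed

lemma Suc_less_P:
  assumes "lo + Suc L ^ n \<le> T" "Suc k < B" shows "Suc k < P j"
proof -
  have "0 < Suc L ^ n" by simp
  then have "0 < T" using assms by linarith
  then have "B ^ 1 \<le> P j" unfolding P_def using B_pos by (intro power_increasing) auto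
  then show ?thesis using assms by simp
qed

section \<open>The cost of the cascade\<close>

text \<open>Optional stopping: the mean of \<open>F\<close> times the expected gain \<open>(L + 2)/2\<close> of a stage is the expected
  total gain, which overshoots \<open>\<Lambda>\<close> by at most one single gain, that is, by \<open>2 ^ L\<close>.\<close>

lemma sum_F_le:
  assumes "lo + Suc L ^ k \<le> T" "k < B"
  shows "(L + 2) * (\<Sum>x<P k. F k lo \<Lambda> x) \<le> 2 * (\<Lambda> + 2 ^ L) * P k"
  using assms
proof (induction k arbitrary: lo \<Lambda>)
  case (Suc k)
  let ?Q = "B ^ (2 * T)" and ?l = "\<lambda>z. lev (cuts k lo) z"
  let ?H = "\<lambda>z. \<Sum>y<P k. F k (lo + (L - ?l z) * Suc L ^ k) (\<Lambda> - 2 ^ ?l z) y"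
  show ?case
  proof (cases "\<Lambda> = 0")
    case False
    have less: "\<forall>p\<in>set (cuts k lo). p < 2 * T" using cuts_less Suc.prems by blast
    have SP: "Suc k < P k" using Suc_less_P Suc.prems by blast
    have "(\<Sum>x<P (Suc k). F (Suc k) lo \<Lambda> x)
        = (\<Sum>z<?Q. \<Sum>y<P k. (if ?l z = L \<and> y = Suc k then P k * 2 ^ L else 0)
            + F k (lo + (L - ?l z) * Suc L ^ k) (\<Lambda> - 2 ^ ?l z) y)"
      unfolding P_Suc mult.commute [of "P k"] sum_lessThan_mult
      by (intro sum.cong refl) (use False P_pos in \<open>auto simp: Let_def\<close>)
    also have "\<dots> = (\<Sum>z<?Q. (if ?l z = L then P k * 2 ^ L else 0)) + (\<Sum>z<?Q. ?H z)"
      unfolding sum.distrib using SP by (auto intro!: sum.cong simp: sum.delta)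
    also have "(\<Sum>z<?Q. (if ?l z = L then P k * 2 ^ L else 0))
        = P k * (2 ^ L * card {z \<in> {..<?Q}. ?l z = L})"
      by (subst sum.inter_filter [symmetric]) auto
    also have "2 ^ L * card {z \<in> {..<?Q}. ?l z = L} = ?Q"
      using card_all_even [OF sorted_cuts less] unfolding lev_eq_L_iff length_cuts by simp
    finally have S: "(\<Sum>x<P (Suc k). F (Suc k) lo \<Lambda> x) = P k * ?Q + (\<Sum>z<?Q. ?H z)" .
    \<comment> \<open>If the stage at \<open>z\<close> reaches the goal, the later stages cost nothing, and its gain is paid for
      by the allowance \<open>2 ^ L\<close> for overshooting.\<close>
    have step: "(L + 2) * ?H z + P k * (2 * 2 ^ ?l z) \<le> 2 * (\<Lambda> + 2 ^ L) * P k" for z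
    proof -
      have lL: "?l z \<le> L" by (rule lev_le)
      have "lo + (L - ?l z) * Suc L ^ k + Suc L ^ k \<le> T"
        using piece_le [of "?l z" k] Suc.prems(1) by linarith
      then have IH: "(L + 2) * ?H z \<le> 2 * ((\<Lambda> - 2 ^ ?l z) + 2 ^ L) * P k"
        using Suc.prems by (intro Suc.IH) auto
      have pw: "(2::nat) ^ ?l z \<le> 2 ^ L" using lL by (intro power_increasing) auto
      show ?thesis
      proof (cases "2 ^ ?l z \<le> \<Lambda>")
        case True
        then obtain d where d: "\<Lambda> = 2 ^ ?l z + d" using le_Suc_ex by blast
        show ?thesis using IH unfolding d by (simp add: algebra_simps)
      next
        case False
        then have "\<Lambda> - 2 ^ ?l z = 0" by simp
        then have "?H z = 0" by (cases k) simp_all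
        moreover have "P k * (2 * 2 ^ ?l z) \<le> P k * (2 * (\<Lambda> + 2 ^ L))"
          using pw by (intro mult_le_mono2) linarith
        ultimately show ?thesis by (simp add: mult.commute)
      qed
    qed
    have "(\<Sum>z<?Q. (L + 2) * ?H z + P k * (2 * 2 ^ ?l z)) \<le> (\<Sum>z<?Q. 2 * (\<Lambda> + 2 ^ L) * P k)"
      by (intro sum_mono step)
    then have "(L + 2) * (\<Sum>z<?Q. ?H z) + P k * (2 * (\<Sum>z<?Q. 2 ^ ?l z))
        \<le> ?Q * (2 * (\<Lambda> + 2 ^ L) * P k)"
      by (simp only: sum.distrib sum_distrib_left sum_constant card_lessThan of_nat_id)
    moreover have "2 * (\<Sum>z<?Q. 2 ^ ?l z) = (L + 2) * ?Q"
      using sum_power_lev [OF sorted_cuts less] by (simp add: length_cuts)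
    ultimately have le: "(L + 2) * (\<Sum>z<?Q. ?H z) + P k * ((L + 2) * ?Q)
        \<le> ?Q * (2 * (\<Lambda> + 2 ^ L) * P k)"
      by simp
    have "(L + 2) * (P k * ?Q + (\<Sum>z<?Q. ?H z)) = (L + 2) * (\<Sum>z<?Q. ?H z) + P k * ((L + 2) * ?Q)"
      by (simp add: algebra_simps)
    also note le
    also have "?Q * (2 * (\<Lambda> + 2 ^ L) * P k) = 2 * (\<Lambda> + 2 ^ L) * P (Suc k)"
      by (simp add: P_Suc)
    finally show ?thesis unfolding S .
  qed simp
qed simp

section \<open>The gain of the cascade\<close>

text \<open>The lowest digit on the support of a stage is the number of the stage, so the supports of
  different stages are disjoint and the visits to them may be added up.\<close>

lemma F_pos_imp_residue:
  assumes "0 < F k lo \<Lambda> x" "k < B" "0 < T" shows "x mod B \<le> k"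
  using assms
proof (induction k arbitrary: lo \<Lambda> x)
  case (Suc k)
  have "B dvd P k" unfolding P_def using Suc.prems by (intro dvd_power) simp
  then have eq: "x mod P k mod B = x mod B" by (rule mod_mod_cancel)
  show ?case
  proof (cases "x mod P k = Suc k")
    case True
    then show ?thesis using eq Suc.prems by simp
  next
    case False
    then have "0 < F k (lo + (L - lev (cuts k lo) (x div P k)) * Suc L ^ k)
        (\<Lambda> - 2 ^ lev (cuts k lo) (x div P k)) (x mod P k)"
      using Suc.prems by (auto simp: Let_def split: if_splits)
    from Suc.IH [OF this] show ?thesis using eq Suc.prems by simp
  qed
qed simp

lemma good_mod: assumes "good x" shows "good (x mod B ^ q)"
  unfolding good_def
proof
  fix p
  show "(x mod B ^ q) div B ^ p mod B \<noteq> B - 1"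
  proof (cases "p < q")
    case True
    then have e: "B ^ q = B ^ p * B ^ (q - p)" by (simp flip: power_add)
    have "(x mod B ^ q) div B ^ p = (x div B ^ p) mod B ^ (q - p)"
      unfolding e by (simp add: mod_mult2_eq B_pos)
    moreover have "B dvd B ^ (q - p)" using True by (intro dvd_power) simp
    ultimately show ?thesis using assms by (simp add: mod_mod_cancel good_def)
  next
    case False
    have "x mod B ^ q < B ^ q" using B_pos by simp
    also have "\<dots> \<le> B ^ p" using False B_pos by (intro power_increasing) auto
    finally show ?thesis using B_ge2 by simp
  qed
qed

lemma card_good: "card {x \<in> {..<B ^ M}. good x} \<ge> (B - 1) ^ M"
proof (induction M)
  case 0
  have "good 0" using B_ge2 by (simp add: good_def)
  then have "{x \<in> {..<B ^ 0}. good x} = {0}" by auto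
  then show ?case by simp
next
  case (Suc M)
  let ?A = "{x \<in> {..<B ^ M}. good x}"
  let ?g = "\<lambda>(u, y). u * B ^ M + y"
  have inj: "inj_on ?g ({..<B - 1} \<times> ?A)"
  proof (rule inj_onI, clarify)
    fix u y u' y'
    assume a: "y < B ^ M" "y' < B ^ M" and "u * B ^ M + y = u' * B ^ M + y'"
    then have "(u * B ^ M + y) div B ^ M = (u' * B ^ M + y') div B ^ M"
      "(u * B ^ M + y) mod B ^ M = (u' * B ^ M + y') mod B ^ M" by simp_all
    then show "u = u' \<and> y = y'" using a B_pos by simp
  qed
  have "?g ` ({..<B - 1} \<times> ?A) \<subseteq> {x \<in> {..<B ^ Suc M}. good x}"
  proof (rule image_subsetI, unfold split_paired_all prod.case)
    fix u y assume "(u, y) \<in> {..<B - 1} \<times> ?A"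
    then have u: "u \<in> {..<B - 1}" and y: "y \<in> {..<B ^ M}" "good y" by auto
    have "u * B ^ M + y < Suc u * B ^ M" using y by simp
    also have "\<dots> \<le> B * B ^ M" using u by (intro mult_le_mono1) auto
    finally have lt: "u * B ^ M + y < B ^ Suc M" by simp
    have "(u * B ^ M + y) div B ^ p mod B \<noteq> B - 1" for p
    proof (cases "p < M")
      case True
      then have e: "B ^ M = B ^ p * (B * B ^ (M - Suc p))"
        by (simp flip: power_add power_Suc add: Suc_diff_Suc)
      have "u * B ^ M + y = y + B ^ p * (B * (u * B ^ (M - Suc p)))"
        unfolding e by (simp add: algebra_simps)
      also have "\<dots> div B ^ p = y div B ^ p + B * (u * B ^ (M - Suc p))"
        using B_pos by simp
      finally show ?thesis using y by (simp add: good_def)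
    next
      case False
      show ?thesis
      proof (cases "p = M")
        case True
        moreover have "(u * B ^ M + y) div B ^ M = u" using y B_pos by simp
        moreover have "u mod B = u" "u \<noteq> B - 1" using u by auto
        ultimately show ?thesis by simp
      next
        case pM: False
        have "B ^ Suc M \<le> B ^ p" using False pM B_pos by (intro power_increasing) auto
        then show ?thesis using lt B_ge2 by simp
      qed
    qed
    then show "u * B ^ M + y \<in> {x \<in> {..<B ^ Suc M}. good x}"
      using lt by (simp add: good_def)
  qed
  then have "card (?g ` ({..<B - 1} \<times> ?A)) \<le> card {x \<in> {..<B ^ Suc M}. good x}"
    by (intro card_mono) auto
  then have "(B - 1) * card ?A \<le> card {x \<in> {..<B ^ Suc M}. good x}"
    by (simp only: card_image [OF inj] card_cartesian_product card_lessThan)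
  moreover have "(B - 1) ^ Suc M \<le> (B - 1) * card ?A" using Suc.IH by simp
  ultimately show ?case by linarith
qed

text \<open>The value of \<open>n\<close> at time \<open>t\<close>. Together with the value \<open>P k * 2 ^ L\<close> of stage \<open>Suc k\<close> it gives a
  window that ends at an odd position, strictly between the cuts at times \<open>t\<close> and \<open>Suc t\<close>.\<close>

definition win :: "nat \<Rightarrow> nat" where "win t = B ^ (2 * t) * D"

lemma win_mult: "win t * (P k * 2 ^ L) = P k * B ^ Suc (2 * t)"
  by (simp add: win_def B_def algebra_simps)

text \<open>A window at a time \<open>t\<close> in the piece of level \<open>l\<close> is a multiple of the periods of the cuts at \<open>t\<close> or
  before, so it sees their exact frequency, a factor \<open>1/2\<close> for each of \<open>L - l\<close> cuts. It is too
  short to change the digits of the \<open>l\<close> later cuts, which \<open>x\<close> has survived, unless there is a carry. This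
  leaves \<open>2 ^ l\<close> as the average of the stage.\<close>

lemma stage_count:
  assumes lo: "lo + Suc L ^ Suc k \<le> T" and kB: "Suc k < B"
    and x: "x < P (Suc k)" "good x"
    and l: "l = lev (cuts k lo) (x div P k)"
    and t: "lo + (L - l) * Suc L ^ k \<le> t" "t < lo + (L - l) * Suc L ^ k + Suc L ^ k"
  defines "S \<equiv> {i \<in> {1..P k * B ^ Suc (2 * t)}. x + i < P (Suc k) \<and> (x + i) mod P k = Suc k
              \<and> lev (cuts k lo) ((x + i) div P k) = L}"
  shows "card S = 2 ^ l * win t"
proof -
  define s where "s = Suc (2 * t)"
  define C where "C = P k * B ^ s"
  define z where "z = x div P k"
  let ?ps = "cuts k lo"
  have Cpos: "0 < C" by (simp add: C_def P_pos B_pos)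
  have lL: "l \<le> L" unfolding l by (rule lev_le)
  have tT: "t < T" using t lo piece_le [of l k] by linarith
  have dig: "(x div C) mod B \<noteq> B - 1"
    using x by (simp add: C_def P_def good_def flip: power_add)
  have same: "(x + i) div (P k * B ^ e) = x div (P k * B ^ e)" if "i \<le> C" "s < e" for i e
  proof -
    have "P k * B ^ e = C * B * B ^ (e - Suc s)"
      using that by (simp add: C_def mult.assoc flip: power_add power_Suc)
    then show ?thesis
      using add_div_no_carry [OF Cpos \<open>i \<le> C\<close> dig B_pos] by (metis div_mult2_eq)
  qed
  have inside: "x + i < P (Suc k)" if "i \<le> C" for i
  proof -
    have "(x + i) div P (Suc k) = x div P (Suc k)"
      unfolding P_Suc using that tT by (intro same) (auto simp: s_def)
    then show ?thesis using x P_pos by (metis div_eq_0_iff div_less less_not_refl)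
  qed
  have upper: "even (z div B ^ p) \<and> s < p" if pin: "p \<in> set (take l ?ps)" for p
  proof
    show "even (z div B ^ p)"
    proof -
      have "take l ?ps = takeWhile (\<lambda>p. even (z div B ^ p)) ?ps"
        unfolding l lev_def z_def by (rule takeWhile_eq_take [symmetric])
      then show ?thesis using that set_takeWhileD by metis
    qed
    obtain i where i: "i < l" "p = 2 * (lo + (L - i) * Suc L ^ k)"
      using pin lL by (auto simp: cuts_def take_map take_upt)
    have "Suc (L - l) * Suc L ^ k \<le> (L - i) * Suc L ^ k" using i lL by (intro mult_le_mono1) auto
    then show "s < p" using i t by (simp add: s_def)
  qed
  have lower: "p < s" if pin: "p \<in> set (drop l ?ps)" for p
  proof -
    obtain i where i: "l \<le> i" "p = 2 * (lo + (L - i) * Suc L ^ k)"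
      using pin by (auto simp: cuts_def drop_map)
    have "(L - i) * Suc L ^ k \<le> (L - l) * Suc L ^ k" using i by (intro mult_le_mono1) auto
    then have "lo + (L - i) * Suc L ^ k \<le> t" by (rule order_trans [OF add_left_mono t(1)])
    then have "p \<le> 2 * t" unfolding i(2) by (rule mult_le_mono2)
    then show "p < s" by (simp add: s_def)
  qed
  have ps: "set ?ps = set (take l ?ps) \<union> set (drop l ?ps)"
    by (metis append_take_drop_id set_append)
  \<comment> \<open>Inside the window, the support of the stage is given by a condition of period \<open>C\<close>.\<close>
  let ?R = "\<lambda>y. y mod P k = Suc k \<and> (\<forall>p\<in>set (drop l ?ps). even (y div P k div B ^ p))"
  have R_mod: "?R (y mod C) = ?R y" for y
  proof -
    have "y mod C mod P k = y mod P k" by (rule mod_mod_cancel) (simp add: C_def)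
    moreover have "y mod C div P k = (y div P k) mod B ^ s"
      by (simp add: C_def mod_mult2_eq P_pos)
    ultimately show ?thesis using lower by (simp add: even_mod_div)
  qed
  have "S = {i \<in> {1..C}. ?R ((x + i) mod C)}"
  proof -
    have "lev ?ps ((x + i) div P k) = L \<longleftrightarrow> (\<forall>p\<in>set (drop l ?ps). even ((x + i) div P k div B ^ p))"
      if "i \<le> C" for i
    proof -
      have "even ((x + i) div P k div B ^ p)" if "p \<in> set (take l ?ps)" for p
        using upper [OF that] same [OF \<open>i \<le> C\<close>, of p] by (simp add: z_def flip: div_mult2_eq)
      then show ?thesis unfolding lev_eq_L_iff ps by blast
    qed
    then show ?thesis
      unfolding S_def R_mod using inside by (auto simp flip: s_def C_def)
  qed
  then have "card S = card {y \<in> {..<C}. ?R y}"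
    using card_window_mod [OF Cpos] by simp
  also have "\<dots> = card {w \<in> {..<B ^ s}. \<forall>p\<in>set (drop l ?ps). even (w div B ^ p)}" (is "_ = card ?W")
  proof -
    have SP: "Suc k < P k" using Suc_less_P lo kB by blast
    have "{y \<in> {..<C}. ?R y} = (\<lambda>w. w * P k + Suc k) ` ?W"
    proof (rule set_eqI, rule iffI)
      fix y assume y: "y \<in> {y \<in> {..<C}. ?R y}"
      then have "y = y div P k * P k + Suc k" by (metis (mono_tags, lifting) div_mult_mod_eq mem_Collect_eq)
      moreover have "y div P k < B ^ s"
        using y P_pos by (simp add: C_def div_less_iff_less_mult mult.commute)
      ultimately show "y \<in> (\<lambda>w. w * P k + Suc k) ` ?W" using y by auto
    next
      fix y assume "y \<in> (\<lambda>w. w * P k + Suc k) ` ?W"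
      then obtain w where w: "w \<in> ?W" "y = w * P k + Suc k" by blast
      have dm: "(w * P k + r) div P k = w" "(w * P k + r) mod P k = r" if "r < P k" for r
        using that by simp_all
      have d: "y div P k = w" "y mod P k = Suc k" unfolding w(2) by (rule dm [OF SP])+
      have "y < Suc w * P k" using w SP by simp
      also have "\<dots> \<le> B ^ s * P k" using w by (intro mult_le_mono1) auto
      finally show "y \<in> {y \<in> {..<C}. ?R y}" using w d by (simp add: C_def mult.commute)
    qed
    moreover have "inj_on (\<lambda>w. w * P k + Suc k) ?W" using P_pos [of k] by (intro inj_onI) simp
    ultimately show ?thesis by (simp only: card_image)
  qed
  finally have cS: "card S = card ?W" .
  have "2 ^ length (drop l ?ps) * card ?W = B ^ s"
    using lower by (intro card_all_even sorted_wrt_drop sorted_cuts ballI)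
  then have "2 ^ (L - l) * card S = B ^ s" by (simp add: cS length_cuts)
  also have "\<dots> = 2 ^ L * win t" by (simp add: s_def win_def flip: B_def)
  also have "2 ^ L = 2 ^ (L - l) * (2 ^ l :: nat)" using lL by (simp flip: power_add)
  finally show ?thesis by simp
qed

text \<open>One time \<open>t\<close> serves all stages simultaneously, because each stage lets the lower ones choose only
  within the piece on which its own gain is \<open>2 ^ l\<close>. The windows of the lower stages do not leave the
  block of \<open>x\<close> modulo \<open>P k\<close>, hence they see a single instance of the lower stages. As every gain is at
  least 1, \<open>k \<ge> \<Lambda>\<close> stages suffice to reach \<open>\<Lambda>\<close>.\<close>

lemma F_count:
  assumes "lo + Suc L ^ k \<le> T" "k < B" "\<Lambda> \<le> k" "x < P k" "good x"
  shows "\<exists>t. lo \<le> t \<and> t < lo + Suc L ^ k \<and>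
    \<Lambda> * win t \<le> card {i. 1 \<le> i \<and> x + i < P k \<and> i \<le> win t * F k lo \<Lambda> (x + i)}"
  using assms
proof (induction k arbitrary: lo \<Lambda> x)
  case 0
  then show ?case by (intro exI [of _ lo]) simp
next
  case (Suc k)
  show ?case
  proof (cases "\<Lambda> = 0")
    case True
    then show ?thesis by (intro exI [of _ lo]) simp
  next
    case False
    define l where "l = lev (cuts k lo) (x div P k)"
    define lo' where "lo' = lo + (L - l) * Suc L ^ k"
    define y where "y = x mod P k"
    have lo': "lo' + Suc L ^ k \<le> lo + Suc L ^ Suc k"
      unfolding lo'_def using piece_le [of l k] by linarith
    have y: "y < P k" "good y" using P_pos good_mod Suc.prems by (auto simp: y_def P_def)
    have "(1::nat) \<le> 2 ^ l" by simp
    then have "\<Lambda> - 2 ^ l \<le> k" using Suc.prems by linarith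
    then obtain t where t: "lo' \<le> t" "t < lo' + Suc L ^ k"
      and IH: "(\<Lambda> - 2 ^ l) * win t
        \<le> card {i. 1 \<le> i \<and> y + i < P k \<and> i \<le> win t * F k lo' (\<Lambda> - 2 ^ l) (y + i)}"
      using Suc.IH [of lo' "\<Lambda> - 2 ^ l" y] lo' Suc.prems y by auto
    let ?S2 = "{i. 1 \<le> i \<and> y + i < P k \<and> i \<le> win t * F k lo' (\<Lambda> - 2 ^ l) (y + i)}"
    let ?S1 = "{i \<in> {1..P k * B ^ Suc (2 * t)}. x + i < P (Suc k) \<and> (x + i) mod P k = Suc k
              \<and> lev (cuts k lo) ((x + i) div P k) = L}"
    let ?S = "{i. 1 \<le> i \<and> x + i < P (Suc k) \<and> i \<le> win t * F (Suc k) lo \<Lambda> (x + i)}"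
    have c1: "card ?S1 = 2 ^ l * win t"
      using Suc.prems t by (intro stage_count) (auto simp: l_def lo'_def)
    have xi: "x + i = x div P k * P k + (y + i)" for i by (simp add: y_def)
    have T0: "0 < T"
    proof -
      have "0 < Suc L ^ Suc k" by simp
      then show ?thesis using Suc.prems(1) by linarith
    qed
    have xdiv: "x div P k < B ^ (2 * T)"
      using Suc.prems P_pos by (simp add: P_Suc div_less_iff_less_mult mult.commute)
    have sub2: "?S2 \<subseteq> ?S"
    proof (rule subsetI)
      fix i assume "i \<in> ?S2"
      then have i: "1 \<le> i" "y + i < P k" "i \<le> win t * F k lo' (\<Lambda> - 2 ^ l) (y + i)"
        by simp_all
      have d: "(x + i) div P k = x div P k" "(x + i) mod P k = y + i"
        unfolding xi using i by simp_all
      have "F k lo' (\<Lambda> - 2 ^ l) (y + i) \<le> F (Suc k) lo \<Lambda> (x + i)"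
        using False by (simp add: d Let_def flip: l_def lo'_def)
      then have "win t * F k lo' (\<Lambda> - 2 ^ l) (y + i) \<le> win t * F (Suc k) lo \<Lambda> (x + i)" by simp
      moreover have "x + i < P (Suc k)"
      proof -
        have "x + i < Suc (x div P k) * P k" unfolding xi using i by simp
        also have "\<dots> \<le> B ^ (2 * T) * P k" using xdiv by (intro mult_le_mono1) auto
        finally show ?thesis by (simp add: P_Suc mult.commute)
      qed
      ultimately show "i \<in> ?S" unfolding mem_Collect_eq using i by linarith
    qed
    have sub1: "?S1 \<subseteq> ?S"
    proof (rule subsetI)
      fix i assume "i \<in> ?S1"
      then have i: "i \<in> {1..P k * B ^ Suc (2 * t)}" "x + i < P (Suc k)" "(x + i) mod P k = Suc k"
        "lev (cuts k lo) ((x + i) div P k) = L" by blast+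
      have "P k * 2 ^ L \<le> F (Suc k) lo \<Lambda> (x + i)" using i False by (simp add: Let_def)
      then have "win t * (P k * 2 ^ L) \<le> win t * F (Suc k) lo \<Lambda> (x + i)" by (rule mult_le_mono2)
      then show "i \<in> ?S"
        unfolding mem_Collect_eq win_mult using i unfolding atLeastAtMost_iff by linarith
    qed
    have disj: "?S1 \<inter> ?S2 = {}"
    proof (rule ccontr)
      assume "?S1 \<inter> ?S2 \<noteq> {}"
      then obtain i where i: "(x + i) mod P k = Suc k" "1 \<le> i" "y + i < P k"
        "i \<le> win t * F k lo' (\<Lambda> - 2 ^ l) (y + i)" by blast
      have "(x + i) mod P k = y + i" unfolding xi using i by simp
      then have "y + i = Suc k" using i by simp
      moreover have "(y + i) mod B \<le> k"
      proof (rule F_pos_imp_residue)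
        show "0 < F k lo' (\<Lambda> - 2 ^ l) (y + i)" using i by (cases "F k lo' (\<Lambda> - 2 ^ l) (y + i)") auto
      qed (use Suc.prems T0 in auto)
      ultimately show False using Suc.prems by simp
    qed
    have finS: "finite ?S" by (rule finite_subset [of _ "{..P (Suc k)}"]) auto
    have "\<Lambda> \<le> 2 ^ l + (\<Lambda> - 2 ^ l)" by linarith
    then have "\<Lambda> * win t \<le> 2 ^ l * win t + (\<Lambda> - 2 ^ l) * win t"
      unfolding add_mult_distrib [symmetric] by (rule mult_le_mono1)
    also have "\<dots> \<le> card ?S1 + card ?S2" using c1 IH by linarith
    also have "\<dots> = card (?S1 \<union> ?S2)"
      using disj finS sub1 sub2 by (intro card_Un_disjoint [symmetric]) (auto intro: finite_subset)
    also have "\<dots> \<le> card ?S" using finS sub1 sub2 by (intro card_mono) auto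
    finally have "\<Lambda> * win t \<le> card ?S" .
    moreover have "lo \<le> t" using t by (simp add: lo'_def)
    moreover have "t < lo + Suc L ^ Suc k" using t lo' by linarith
    ultimately show ?thesis by (intro exI [of _ t] conjI)
  qed
qed

end

text \<open>The cascade with \<open>\<Lambda> = K = 2 ^ L\<close>. There are \<open>M\<close> digits, and each is the largest one with probability
  \<open>1/B\<close>, so \<open>B \<ge> 2 * M\<close> makes at least half of the points good. This choice is not circular, since the number of
  digits depends on \<open>L\<close> only.\<close>

lemma exists_cascade_function:
  fixes L :: nat
  obtains R :: nat and F :: "nat \<Rightarrow> nat" and G where
    "0 < R" "0 < (\<Sum>x<R. F x)" "(L + 2) * (\<Sum>x<R. F x) \<le> 4 * 2 ^ L * R"
    "G \<subseteq> {..<R}" "R \<le> 2 * card G"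
    "\<And>x. x \<in> G \<Longrightarrow> \<exists>n\<ge>1. 2 ^ L * n \<le> card {i. 1 \<le> i \<and> x + i < R \<and> i \<le> n * F (x + i)}"
proof -
  define K :: nat where "K = 2 ^ L"
  define T where "T = Suc L ^ K"
  define M where "M = Suc K * (2 * T)"
  define D where "D = 2 * Suc M"
  interpret cascade L D T by standard (auto simp: D_def)
  have M_B: "2 * M \<le> B" and K_B: "K < B"
  proof -
    have "1 * D \<le> 2 ^ L * D" by (intro mult_le_mono1) simp
    then show "2 * M \<le> B" unfolding B_def by (simp add: D_def)
    have "K * 2 \<le> B" unfolding B_def K_def by (intro mult_le_mono2) (simp add: D_def)
    moreover have "0 < K" by (simp add: K_def)
    ultimately show "K < B" by linarith
  qed
  have PM: "P K = B ^ M" by (simp add: P_def M_def)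
  define G where "G = {x \<in> {..<P K}. good x}"
  have T0: "0 + Suc L ^ K \<le> T" by (simp add: T_def)
  have half: "P K \<le> 2 * card G"
  proof -
    have "1 - real M / real B \<le> (1 - 1 / real B) ^ M"
      using Bernoulli_inequality [of "- 1 / real B" M] B_pos by (simp add: field_simps)
    moreover have "real M / real B \<le> 1 / 2"
      using M_B B_pos by (simp add: field_simps)
    ultimately have "1 / 2 \<le> (1 - 1 / real B) ^ M" by linarith
    also have "1 - 1 / real B = real (B - 1) / real B"
      using B_pos by (simp add: field_simps of_nat_diff)
    also have "(real (B - 1) / real B) ^ M = real (B - 1) ^ M / real B ^ M"
      by (rule power_divide)
    finally have "real B ^ M \<le> 2 * real (B - 1) ^ M" using B_pos by (simp add: field_simps)
    then have "real (B ^ M) \<le> real (2 * (B - 1) ^ M)" by simp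
    then have "B ^ M \<le> 2 * (B - 1) ^ M" by linarith
    then show ?thesis using card_good [of M] unfolding G_def PM by linarith
  qed
  have count: "\<exists>n\<ge>1. 2 ^ L * n \<le> card {i. 1 \<le> i \<and> x + i < P K \<and> i \<le> n * F K 0 K (x + i)}"
    if x: "x \<in> G" for x
  proof -
    obtain t where "K * win t \<le> card {i. 1 \<le> i \<and> x + i < P K \<and> i \<le> win t * F K 0 K (x + i)}"
      using F_count [OF T0 K_B order_refl, of x] x unfolding G_def by blast
    moreover have "1 \<le> win t" using B_pos D_pos by (simp add: win_def)
    ultimately show ?thesis unfolding K_def by blast
  qed
  show ?thesis
  proof
    show "0 < P K" by (rule P_pos)
    show "(L + 2) * (\<Sum>x<P K. F K 0 K x) \<le> 4 * 2 ^ L * P K"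
      using sum_F_le [OF T0 K_B, of K] unfolding K_def by simp
    show "G \<subseteq> {..<P K}" by (auto simp: G_def)
    show "P K \<le> 2 * card G" by (rule half)
    show "0 < (\<Sum>x<P K. F K 0 K x)"
    proof -
      have "card G \<noteq> 0" using half P_pos [of K] by linarith
      then obtain x where x: "x \<in> G" by fastforce
      then obtain n where n: "n \<ge> 1"
        "2 ^ L * n \<le> card {i. 1 \<le> i \<and> x + i < P K \<and> i \<le> n * F K 0 K (x + i)}"
        using count by blast
      moreover have "0 < 2 ^ L * n" using n by simp
      ultimately have "card {i. 1 \<le> i \<and> x + i < P K \<and> i \<le> n * F K 0 K (x + i)} \<noteq> 0" by linarith
      then have "{i. 1 \<le> i \<and> x + i < P K \<and> i \<le> n * F K 0 K (x + i)} \<noteq> {}"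
        by (rule contrapos_nn) (simp only: card.empty)
      then obtain i where i: "1 \<le> i" "x + i < P K" "i \<le> n * F K 0 K (x + i)"
        by blast
      have "0 < F K 0 K (x + i)" using i by (cases "F K 0 K (x + i)") auto
      also have "\<dots> \<le> (\<Sum>x<P K. F K 0 K x)" using i by (intro member_le_sum) auto
      finally show ?thesis .
    qed
    show "\<And>x. x \<in> G \<Longrightarrow> \<exists>n\<ge>1. 2 ^ L * n \<le> card {i. 1 \<le> i \<and> x + i < P K \<and> i \<le> n * F K 0 K (x + i)}"
      by (rule count)
  qed
qed

section \<open>Transfer to a finite rotation\<close>

definition rotate_mod :: "nat \<Rightarrow> real \<Rightarrow> real" where
  "rotate_mod R x = real (Suc (nat \<lfloor>x\<rfloor>) mod R)"

lemma bij_rotate_mod: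
  assumes "0 < R"
  shows "bij_betw (rotate_mod R) (real ` {..<R}) (real ` {..<R})"
proof -
  have sub: "rotate_mod R ` (real ` {..<R}) \<subseteq> real ` {..<R}"
    using assms by (auto simp: rotate_mod_def)
  have "real x \<in> rotate_mod R ` (real ` {..<R})" if "x < R" for x
  proof (cases x)
    case 0
    obtain y where y: "R = Suc y" using assms by (cases R) auto
    have "real x = rotate_mod R (real y)" using 0 y by (simp add: rotate_mod_def)
    then show ?thesis using y by (intro image_eqI [of _ _ "real y"]) auto
  next
    case (Suc y)
    have "real x = rotate_mod R (real y)" using that Suc by (simp add: rotate_mod_def)
    then show ?thesis using that Suc by (intro image_eqI [of _ _ "real y"]) auto
  qed
  then have img: "rotate_mod R ` (real ` {..<R}) = real ` {..<R}" using sub by blast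
  then have "inj_on (rotate_mod R) (real ` {..<R})" by (intro eq_card_imp_inj_on) auto
  then show ?thesis using img by (simp add: bij_betw_def)
qed

lemma rotate_mod_funpow:
  "x + i < R \<Longrightarrow> (rotate_mod R ^^ i) (real x) = real (x + i)"
  by (induction i) (simp_all add: rotate_mod_def)

lemma rotation_system:
  assumes "0 < R"
  shows "measure_preserving_system (uniform_count_measure (real ` {..<R})) (rotate_mod R)"
proof -
  let ?A = "real ` {..<R}"
  let ?M = "uniform_count_measure ?A"
  have bij: "bij_betw (rotate_mod R) ?A ?A" using assms by (rule bij_rotate_mod)
  have meas: "g \<in> ?M \<rightarrow>\<^sub>M ?M" if "g ` ?A \<subseteq> ?A" for g
    using that by (auto simp: measurable_def space_uniform_count_measure sets_uniform_count_measure)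
  have T: "rotate_mod R \<in> ?M \<rightarrow>\<^sub>M ?M" using bij by (intro meas) (simp add: bij_betw_def)
  have "distr ?M ?M (rotate_mod R) = ?M"
  proof (rule measure_eqI)
    fix X assume "X \<in> sets (distr ?M ?M (rotate_mod R))"
    then have X: "X \<subseteq> ?A" by (simp add: sets_uniform_count_measure)
    have "bij_betw (rotate_mod R) (rotate_mod R -` X \<inter> ?A) X"
      unfolding bij_betw_def
    proof
      show "inj_on (rotate_mod R) (rotate_mod R -` X \<inter> ?A)"
        using bij by (auto simp: bij_betw_def intro: inj_on_subset)
      have "X \<subseteq> rotate_mod R ` ?A" using bij X by (simp add: bij_betw_def)
      then show "rotate_mod R ` (rotate_mod R -` X \<inter> ?A) = X"
      proof (intro subset_antisym subsetI)
        fix y assume y: "y \<in> X"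
        with \<open>X \<subseteq> rotate_mod R ` ?A\<close> obtain x where "x \<in> ?A" "y = rotate_mod R x"
          by blast
        with y show "y \<in> rotate_mod R ` (rotate_mod R -` X \<inter> ?A)" by auto
      qed auto
    qed
    then have "card (rotate_mod R -` X \<inter> ?A) = card X" by (rule bij_betw_same_card)
    then show "emeasure (distr ?M ?M (rotate_mod R)) X = emeasure ?M X"
      using X T by (simp add: emeasure_distr sets_uniform_count_measure space_uniform_count_measure
          emeasure_uniform_count_measure)
  qed simp
  moreover have "prob_space ?M"
    using assms by (intro prob_space_uniform_count_measure) auto
  moreover have "the_inv_into ?A (rotate_mod R) \<in> ?M \<rightarrow>\<^sub>M ?M"
    using bij_betw_the_inv_into [OF bij] by (intro meas) (simp add: bij_betw_def)
  ultimately show ?thesis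
    using T bij by (simp add: measure_preserving_system_def measure_preserving_def
        space_uniform_count_measure)
qed

text \<open>The counting property only concerns orbit segments that do not wrap around, where the rotation is
  the translation of the integers. Normalising \<open>F\<close> by its mean \<open>c \<le> J\<close> replaces \<open>n\<close> by the integer \<open>m\<close> next
  above \<open>n * J\<close>, which also turns \<open>i \<le> n * F (x + i)\<close> into a strict inequality. Rounding makes
  \<open>m\<close> at most \<open>2 * n * J\<close>; the constant 3 keeps the bound for the supremum strict.\<close>

lemma rotation_weak_type_bound:
  fixes F :: "nat \<Rightarrow> nat" and J \<Lambda> :: real
  assumes R: "0 < R" and pos: "0 < (\<Sum>x<R. F x)" and J: "real (\<Sum>x<R. F x) \<le> J * real R" "1 \<le> J"
    and G: "G \<subseteq> {..<R}" "R \<le> 2 * card G" and \<Lambda>: "0 < \<Lambda>"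
    and count: "\<And>x. x \<in> G \<Longrightarrow>
      \<exists>n\<ge>1. \<Lambda> * real n \<le> real (card {i. 1 \<le> i \<and> x + i < R \<and> i \<le> n * F (x + i)})"
  defines "M \<equiv> uniform_count_measure (real ` {..<R})"
  obtains f :: "real \<Rightarrow> real" where "f \<in> L1_plus M" "L1_norm M f = 1"
    "ennreal (\<Lambda> / (6 * J)) \<le> ennreal (\<Lambda> / (3 * J)) * emeasure M {x \<in> space M.
        (SUP n \<in> {(1 :: nat) ..}. count_N (rotate_mod R) n f x / of_nat n) > ennreal (\<Lambda> / (3 * J))}"
proof -
  define c where "c = real (\<Sum>x<R. F x) / real R"
  define f where "f = (\<lambda>x :: real. real (F (nat \<lfloor>x\<rfloor>)) / c)"
  let ?A = "real ` {..<R}"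
  let ?S = "{x \<in> space M.
        (SUP n \<in> {(1 :: nat) ..}. count_N (rotate_mod R) n f x / of_nat n) > ennreal (\<Lambda> / (3 * J))}"
  have rpos: "0 < real (\<Sum>x<R. F x)" using pos by (simp only: of_nat_0_less_iff)
  then have c: "0 < c" "c \<le> J" using R J by (auto simp: c_def divide_simps simp del: of_nat_sum)
  have "integrable M f"
    unfolding M_def uniform_count_measure_def by (rule integrable_point_measure_finite) simp
  then have f1: "f \<in> L1_plus M" using c by (simp add: L1_plus_def f_def)
  have "(\<Sum>x\<in>?A. \<bar>f x\<bar>) = (\<Sum>x<R. real (F x)) / c"
    using c by (subst sum.reindex) (auto simp: f_def sum_divide_distrib)
  then have f2: "L1_norm M f = 1"
    using R rpos unfolding L1_norm_def M_def
    by (simp add: integral_uniform_count_measure card_image c_def)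
  have "real ` G \<subseteq> ?S"
  proof (rule image_subsetI)
    fix x assume x: "x \<in> G"
    then obtain n where n: "n \<ge> 1"
      "\<Lambda> * real n \<le> real (card {i. 1 \<le> i \<and> x + i < R \<and> i \<le> n * F (x + i)})" (is "_ \<le> real (card ?I)")
      using count by blast
    define m where "m = Suc (nat \<lfloor>real n * J\<rfloor>)"
    have mpos: "0 < real m" by (simp add: m_def)
    have m: "real n * J < real m" "real m \<le> real n * J + 1"
      using J unfolding m_def by (auto simp: of_nat_nat floor_less_iff) linarith+
    have "1 * 1 \<le> real n * J" using n J by (intro mult_mono) auto
    then have m2: "real m < 3 * (real n * J)" using m by linarith
    have "?I \<subseteq> {k. 1 \<le> k \<and> f ((rotate_mod R ^^ k) (real x)) / real k > 1 / real m}"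
    proof (rule subsetI)
      fix i assume "i \<in> ?I"
      then have i: "1 \<le> i" "x + i < R" "i \<le> n * F (x + i)" by auto
      have Fpos: "0 < F (x + i)" using i by (cases "F (x + i)") auto
      have "real i * c \<le> real (n * F (x + i)) * J"
        using i c by (intro mult_mono) (auto simp del: of_nat_mult)
      also have "\<dots> = (real n * J) * real (F (x + i))" by simp
      also have "\<dots> < real m * real (F (x + i))"
        using Fpos m by (intro mult_strict_right_mono) auto
      finally have "1 / real m < real (F (x + i)) / c / real i"
        using i c mpos by (simp add: field_simps)
      then show "i \<in> {k. 1 \<le> k \<and> f ((rotate_mod R ^^ k) (real x)) / real k > 1 / real m}"
        using i by (simp add: rotate_mod_funpow f_def del: of_nat_add)
    qed
    then have "emeasure (count_space UNIV) ?I \<le> count_N (rotate_mod R) m f (real x)"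
      unfolding count_N_def by (intro emeasure_mono) auto
    moreover have "finite ?I" by (rule finite_subset [of _ "{..R}"]) auto
    ultimately have "ennreal (real (card ?I)) \<le> count_N (rotate_mod R) m f (real x)"
      by (simp add: emeasure_count_space_finite ennreal_of_nat_eq_real_of_nat)
    then have "ennreal (real (card ?I)) / of_nat m \<le> count_N (rotate_mod R) m f (real x) / of_nat m"
      by (rule divide_right_mono_ennreal)
    moreover have "ennreal (\<Lambda> / (3 * J)) < ennreal (real (card ?I)) / of_nat m"
    proof -
      have "\<Lambda> * real m < \<Lambda> * (3 * (real n * J))" using m2 \<Lambda> by (rule mult_strict_left_mono)
      also have "\<dots> = (\<Lambda> * real n) * (3 * J)" by simp
      also have "\<dots> \<le> real (card ?I) * (3 * J)" using n J by (intro mult_right_mono) auto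
      finally have "\<Lambda> / (3 * J) < real (card ?I) / real m"
        using J mpos by (simp add: field_simps)
      moreover have "ennreal (real (card ?I)) / of_nat m = ennreal (real (card ?I) / real m)"
        using mpos by (simp add: ennreal_of_nat_eq_real_of_nat divide_ennreal)
      ultimately show ?thesis using \<Lambda> J by (simp add: ennreal_less_iff)
    qed
    ultimately have "ennreal (\<Lambda> / (3 * J)) < count_N (rotate_mod R) m f (real x) / of_nat m" by simp
    also have "\<dots> \<le> (SUP n \<in> {(1 :: nat) ..}. count_N (rotate_mod R) n f (real x) / of_nat n)"
      by (rule SUP_upper) (simp add: m_def)
    finally show "real x \<in> ?S"
      using x G by (auto simp: M_def space_uniform_count_measure)
  qed
  then have "emeasure M (real ` G) \<le> emeasure M ?S"
    by (intro emeasure_mono) (auto simp: M_def sets_uniform_count_measure space_uniform_count_measure)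
  moreover have "emeasure M (real ` G) = ennreal (real (card G) / real R)"
  proof -
    have "real ` G \<subseteq> ?A" using G by auto
    then show ?thesis by (simp add: M_def emeasure_uniform_count_measure card_image)
  qed
  moreover have "ennreal (1 / 2) \<le> ennreal (real (card G) / real R)"
    using G R by (intro ennreal_leI) (simp add: field_simps)
  ultimately have "ennreal (1 / 2) \<le> emeasure M ?S" by simp
  then have "ennreal (\<Lambda> / (3 * J)) * ennreal (1 / 2) \<le> ennreal (\<Lambda> / (3 * J)) * emeasure M ?S"
    by (rule mult_left_mono) simp
  moreover have "ennreal (\<Lambda> / (3 * J)) * ennreal (1 / 2) = ennreal (\<Lambda> / (6 * J))"
    using \<Lambda> J by (subst ennreal_mult [symmetric]) auto
  ultimately show ?thesis using that f1 f2 by simp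
qed

lemma ennreal_eq_infinity_if_ge_of_nat:
  fixes s c :: ennreal
  assumes "\<And>L :: nat. of_nat L \<le> c * s" "c \<noteq> top"
  shows "s = \<infinity>"
proof -
  have "(SUP L :: nat. of_nat L) \<le> c * s" by (rule SUP_least) (rule assms)
  then have "c * s = top" by (simp add: ennreal_SUP_of_nat_eq_top top_unique)
  then show ?thesis using assms by (auto simp: ennreal_mult_eq_top_iff)
qed

theorem theorem1:
  "(SUP (M, T) \<in> {(M :: real measure, T). measure_preserving_system M T}.
      SUP f \<in> {f \<in> L1_plus M. L1_norm M f = 1}.
        SUP r \<in> {(0 :: real) <..}.
          ennreal r * emeasure M {x \<in> space M.
            (SUP n \<in> {(1 :: nat) ..}. count_N T n f x / of_nat n) > ennreal r}) = \<infinity>"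
  (is "?sup = \<infinity>")
proof -
  have "of_nat L \<le> 24 * ?sup" for L :: nat
  proof -
    obtain R F G where c: "0 < R" "0 < (\<Sum>x<R. F x)" "(L + 2) * (\<Sum>x<R. F x) \<le> 4 * 2 ^ L * R"
      "G \<subseteq> {..<R}" "R \<le> 2 * card G"
      "\<And>x. x \<in> G \<Longrightarrow> \<exists>n\<ge>1. 2 ^ L * n \<le> card {i. 1 \<le> i \<and> x + i < R \<and> i \<le> n * F (x + i)}"
      using exists_cascade_function [of L] by blast
    define J where "J = 4 * 2 ^ L / (real L + 2)"
    let ?M = "uniform_count_measure (real ` {..<R})"
    have "real ((L + 2) * (\<Sum>x<R. F x)) \<le> real (4 * 2 ^ L * R)" using c(3) by (simp only: of_nat_le_iff)
    then have J1: "real (\<Sum>x<R. F x) \<le> J * real R" by (simp add: J_def field_simps)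
    have "real L < 2 ^ L" by (rule of_nat_less_two_power)
    moreover have "(1::real) \<le> 2 ^ L" by simp
    ultimately have "real L + 2 \<le> 4 * 2 ^ L" by linarith
    then have J2: "1 \<le> J" by (simp add: J_def)
    have "\<exists>n\<ge>1. 2 ^ L * real n \<le> real (card {i. 1 \<le> i \<and> x + i < R \<and> i \<le> n * F (x + i)})"
      if x: "x \<in> G" for x
    proof -
      obtain n where n: "n \<ge> 1"
        "2 ^ L * n \<le> card {i. 1 \<le> i \<and> x + i < R \<and> i \<le> n * F (x + i)}"
        using c(6) [OF x] by blast
      have "real (2 ^ L * n) \<le> real (card {i. 1 \<le> i \<and> x + i < R \<and> i \<le> n * F (x + i)})"
        using n(2) by (simp only: of_nat_le_iff)
      then show ?thesis using n(1) by auto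
    qed
    from rotation_weak_type_bound [OF c(1,2) J1 J2 c(4,5) _ this]
    obtain f where f: "f \<in> L1_plus ?M" "L1_norm ?M f = 1"
      "ennreal (2 ^ L / (6 * J)) \<le> ennreal (2 ^ L / (3 * J)) * emeasure ?M {x \<in> space ?M.
        (SUP n \<in> {(1 :: nat) ..}. count_N (rotate_mod R) n f x / of_nat n) > ennreal (2 ^ L / (3 * J))}"
      by auto
    let ?w = "\<lambda>M T f r. ennreal r * emeasure M {x \<in> space M.
        (SUP n \<in> {(1 :: nat) ..}. count_N T n f x / of_nat n) > ennreal r}"
    note f(3)
    also have "?w ?M (rotate_mod R) f (2 ^ L / (3 * J)) \<le> (SUP r \<in> {0 <..}. ?w ?M (rotate_mod R) f r)"
      by (rule SUP_upper) (use J2 in auto)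
    also have "\<dots> \<le> (SUP f \<in> {f \<in> L1_plus ?M. L1_norm ?M f = 1}. SUP r \<in> {0 <..}. ?w ?M (rotate_mod R) f r)"
      by (rule SUP_upper) (use f in auto)
    also have "\<dots> \<le> ?sup"
      by (rule SUP_upper2 [of "(?M, rotate_mod R)"]) (use rotation_system [OF c(1)] in auto)
    finally have le: "ennreal (2 ^ L / (6 * J)) \<le> ?sup" .
    \<comment> \<open>With this \<open>J\<close>, the lower bound \<open>2 ^ L / (6 * J)\<close> equals \<open>(L + 2) / 24\<close>.\<close>
    have "of_nat L = ennreal (real L)" by (simp add: ennreal_of_nat_eq_real_of_nat)
    also have "\<dots> \<le> ennreal (24 * (2 ^ L / (6 * J)))"
      by (intro ennreal_leI) (simp add: J_def field_simps)
    also have "\<dots> = 24 * ennreal (2 ^ L / (6 * J))" using J2 by (subst ennreal_mult) auto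
    also have "\<dots> \<le> 24 * ?sup" using le by (rule mult_left_mono) simp
    finally show ?thesis .
  qed
  then show ?thesis by (rule ennreal_eq_infinity_if_ge_of_nat) simp
qed

end
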